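(* Let $\mathcal{N}=(\mathcal{V},\mathcal{E},s,t)$ be a network with $n$ edges, let $m$ be the size of a minimum cut-set, and for $m\le i\le n$ let $A_i$ be the number of cut-sets of size $i$. Suppose that links are in outage independently, each with probability $p$, so that the outage polynomial of the network is $$O(p)=\sum_{i=m}^{n} A_i\,p^i(1-p)^{n-i}.$$ Then $O(p)\sim A_m p^m$, that is, $$\lim_{p\to 0}\frac{O(p)}{A_m p^m}=1 .$$ Thus the diversity order $d$ of the network is equal to the size of a minimum cut-set, $d=m$, and the coding gain $\alpha$ is equal to the number of distinct minimum cut-sets, $\alpha=A_m$.
   Context: A network $\mathcal{N}=(\mathcal{V},\mathcal{E},s,t)$ is a directed acyclic network with finite vertex set $\mathcal{V}$ of communication nodes, a multi-set of $n$ directed edges (communication links) $\mathcal{E}=\{e_1,\dots,e_n\}$ (parallel edges allowed, regarded as distinct edges), a source vertex $s$ and a terminal vertex $t$, with $s\ne t$. A cut-set is a subset $\mathcal{C}\subseteq\mathcal{E}$ whose removal from the network leaves no directed path from $s$ to $t$. Cut-sets need not be inclusion-minimal. A minimum cut-set is a cut-set having the least number of edges among all cut-sets; $m$ denotes this least number. Hence $A_m$ is the number of distinct minimum cut-sets, and $A_m\neq 0$. At a given time instant each link is randomly in outage or not. The residual network is obtained from $\mathcal{N}$ by deleting the links in outage. The outage polynomial $O(p)$ is the probability that there is no directed path from $s$ to $t$ in the residual network, when the links are in outage independently, each with probability $p$. For functions $f,g$ of $p$, $f(p)\sim g(p)$ means $\lim_{p\to0} f(p)/g(p)=1$. Diversity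 order and coding gain: the limit $p\to 0$ is referred to as the high SNR (signal-to-noise ratio) regime. In this regime the outage probability of the network is written as $O(p)\approx\alpha\gamma^{-d}$, where $\gamma$ denotes the average link SNR. The exponent $d$ is called the diversity gain (diversity order); it measures the number of independent copies of the transmitted signal that are received at the terminal node. The factor $\alpha$ is called the coding gain; it measures the performance difference between the given system and a baseline system having $O(p)\approx\gamma^{-d}$. In the theorem, $d$ and $\alpha$ are read off from $O(p)\sim A_m p^m$ as the exponent and the coefficient of the leading term, i.e. with $p$ in the role of $\gamma^{-1}$; no particular fading distribution is assumed. *)

theory Defs
  imports "HOL-Probability.Probability" "Graph_Theory.Graph_Theory"
begin

text \<open>
  Vertices and edges are separate types and each edge carries its own tail and head, so that
  parallel edges are distinct elements of \<open>arcs N\<close>. The notion of cycle covers loops.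
\<close>

locale network = fin_digraph N for N :: "('v, 'e) pre_digraph" (structure) +
  fixes s t :: 'v
  assumes acyclic: "\<not> (\<exists>c. cycle c)"
    and source_in_verts: "s \<in> verts N"
    and terminal_in_verts: "t \<in> verts N"
    and source_neq_terminal: "s \<noteq> t"

definition delete_links :: "('v, 'e) pre_digraph \<Rightarrow> 'e set \<Rightarrow> ('v, 'e) pre_digraph" where
  "delete_links N F = N\<lparr>arcs := arcs N - F\<rparr>"

definition has_path :: "('v, 'e) pre_digraph \<Rightarrow> 'v \<Rightarrow> 'v \<Rightarrow> bool" where
  "has_path N u v \<longleftrightarrow> (\<exists>p. pre_digraph.apath N u p v)"

definition cut_set :: "('v, 'e) pre_digraph \<Rightarrow> 'v \<Rightarrow> 'v \<Rightarrow> 'e set \<Rightarrow> bool" where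
  "cut_set N s t C \<longleftrightarrow> C \<subseteq> arcs N \<and> \<not> has_path (delete_links N C) s t"

definition minimum_cut_set :: "('v, 'e) pre_digraph \<Rightarrow> 'v \<Rightarrow> 'v \<Rightarrow> 'e set \<Rightarrow> bool" where
  "minimum_cut_set N s t C \<longleftrightarrow> cut_set N s t C \<and> (\<forall>D. cut_set N s t D \<longrightarrow> card C \<le> card D)"

definition min_cut_size :: "('v, 'e) pre_digraph \<Rightarrow> 'v \<Rightarrow> 'v \<Rightarrow> nat" where
  "min_cut_size N s t = (LEAST k. \<exists>C. cut_set N s t C \<and> card C = k)"

definition num_cut_sets :: "('v, 'e) pre_digraph \<Rightarrow> 'v \<Rightarrow> 'v \<Rightarrow> nat \<Rightarrow> nat" where
  "num_cut_sets N s t i = card {C. cut_set N s t C \<and> card C = i}"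

text \<open>
  An outcome \<open>\<omega>\<close> tells which links are in outage (\<open>\<omega> e = True\<close>); under the product distribution
  the links of \<open>N\<close> are in outage independently. The value \<open>False\<close> is only the default off
  \<open>arcs N\<close>. For \<open>p\<close> outside \<open>[0, 1]\<close> the library clamps the Bernoulli parameter, so the
  values are meaningful for \<open>0 \<le> p \<le> 1\<close> only.
\<close>

definition link_outages :: "('v, 'e) pre_digraph \<Rightarrow> real \<Rightarrow> ('e \<Rightarrow> bool) pmf" where
  "link_outages N p = Pi_pmf (arcs N) False (\<lambda>_. bernoulli_pmf p)"

definition outage_prob :: "('v, 'e) pre_digraph \<Rightarrow> 'v \<Rightarrow> 'v \<Rightarrow> real \<Rightarrow> real" where
  "outage_prob N s t p =
     measure_pmf.prob (link_outages N p)
       {\<omega>. \<not> has_path (delete_links N {e \<in> arcs N. \<omega> e}) s t}"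

text \<open>
  The high SNR law \<open>f \<approx> \<alpha> \<gamma>\<^sup>-\<^sup>d\<close>, with \<open>p\<close> in the role of \<open>1 / \<gamma>\<close> and a real exponent \<open>d\<close>. As \<open>p\<close> is
  a probability, it tends to \<open>0\<close> from the right. The limit \<open>1\<close> forces \<open>\<alpha> \<noteq> 0\<close>, because
  division by \<open>0\<close> gives \<open>0\<close>; \<open>\<alpha>\<close> and \<open>d\<close> are unique when they exist.
\<close>

definition high_snr_law :: "(real \<Rightarrow> real) \<Rightarrow> real \<Rightarrow> real \<Rightarrow> bool" where
  "high_snr_law f \<alpha> d \<longleftrightarrow> ((\<lambda>p. f p / (\<alpha> * p powr d)) \<longlongrightarrow> 1) (at_right 0)"

definition diversity_order :: "(real \<Rightarrow> real) \<Rightarrow> real" where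
  "diversity_order f = (THE d. \<exists>\<alpha>. high_snr_law f \<alpha> d)"

definition coding_gain :: "(real \<Rightarrow> real) \<Rightarrow> real" where
  "coding_gain f = (THE \<alpha>. \<exists>d. high_snr_law f \<alpha> d)"

end

theory Submission
  imports Defs
begin

text \<open>
  Sorting the outcomes by the set of links in outage gives the outage polynomial. Dividing it by
  \<open>A\<^sub>m p\<^sup>m\<close> leaves \<open>\<Sum>i=m..n. A\<^sub>i / A\<^sub>m * p ^ (i - m) * (1 - p) ^ (n - i)\<close>, which is continuous in \<open>p\<close>
  and equals \<open>1\<close> at \<open>p = 0\<close>. A power law \<open>\<alpha> p\<^sup>d\<close> is determined by its asymptotics at \<open>0\<close>, hence
  diversity order and coding gain can be read off from the leading term.
\<close>

text \<open>The quotient of the two normalized functions tends to 1, and \<open>f\<close> cancels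
  from it. What remains is \<open>b / a * p powr (e - d)\<close>, which would tend to 0 if
  \<open>e\<close> exceeded \<open>d\<close>.\<close>

lemma high_snr_law_exponent_le:
  assumes "high_snr_law f a d" "high_snr_law f b e"
  shows "e \<le> d"
proof (rule ccontr)
  assume "\<not> e \<le> d"
  have "((\<lambda>p. (f p / (a * p powr d)) / (f p / (b * p powr e))) \<longlongrightarrow> 1 / 1) (at_right 0)"
    using assms unfolding high_snr_law_def by (intro tendsto_divide) auto
  \<comment> \<open>A quotient with limit 1 is eventually nonzero, so \<open>f p\<close> is nonzero
    near 0 and may be cancelled.\<close>
  moreover have "\<forall>\<^sub>F p in at_right 0. f p / (a * p powr d) \<noteq> 0"
    using assms(1) unfolding high_snr_law_def by (rule tendsto_imp_eventually_ne) simp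
  then have "\<forall>\<^sub>F p in at_right 0.
      (f p / (a * p powr d)) / (f p / (b * p powr e)) = b / a * p powr (e - d)"
    by eventually_elim (simp add: powr_diff)
  ultimately have "((\<lambda>p. b / a * p powr (e - d)) \<longlongrightarrow> 1) (at_right 0)"
    by (simp add: tendsto_cong)
  moreover have "((\<lambda>p. b / a * p powr (e - d)) \<longlongrightarrow> b / a * 0) (at_right (0::real))"
  proof (intro tendsto_mult tendsto_const)
    have "((\<lambda>p::real. p) \<longlongrightarrow> 0) (at_right 0)" by (rule tendsto_ident_at)
    moreover have "\<forall>\<^sub>F p in at_right (0::real). 0 \<le> p"
      using eventually_at_right_less by (rule eventually_mono) simp
    ultimately show "((\<lambda>p. p powr (e - d)) \<longlongrightarrow> 0) (at_right (0::real))"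
      using tendsto_zero_powrI[OF _ tendsto_const, of "\<lambda>p::real. p" "at_right 0" "e - d"] \<open>\<not> e \<le> d\<close>
      by simp
  qed
  ultimately show False
    using tendsto_unique[OF trivial_limit_at_right_real] by fastforce
qed

text \<open>Exchanging the two laws bounds the exponents both ways. Once they agree, the same
  quotient is the constant \<open>b / a\<close>, whose limit is 1.\<close>

lemma high_snr_law_unique:
  assumes "high_snr_law f a d" "high_snr_law f b e"
  shows "a = b" "d = e"
proof -
  show de: "d = e"
    using high_snr_law_exponent_le assms by (meson order_antisym)
  have "((\<lambda>p. (f p / (a * p powr d)) / (f p / (b * p powr e))) \<longlongrightarrow> 1 / 1) (at_right 0)"
    using assms unfolding high_snr_law_def by (intro tendsto_divide) auto
  moreover have "\<forall>\<^sub>F p in at_right 0. f p / (a * p powr d) \<noteq> 0"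
    using assms(1) unfolding high_snr_law_def by (rule tendsto_imp_eventually_ne) simp
  then have "\<forall>\<^sub>F p in at_right 0. (f p / (a * p powr d)) / (f p / (b * p powr e)) = b / a"
    by eventually_elim (simp add: de)
  ultimately have "((\<lambda>p::real. b / a) \<longlongrightarrow> 1) (at_right 0)"
    by (simp add: tendsto_cong)
  then have "b / a = 1"
    by (simp only: tendsto_const_iff[OF trivial_limit_at_right_real])
  then show "a = b" by (simp add: divide_eq_1_iff)
qed

lemma diversity_order_eq: "high_snr_law f a d \<Longrightarrow> diversity_order f = d"
  unfolding diversity_order_def using high_snr_law_unique(2) by (intro the_equality) blast+

lemma coding_gain_eq: "high_snr_law f a d \<Longrightarrow> coding_gain f = a"
  unfolding coding_gain_def using high_snr_law_unique(1) by (intro the_equality) blast+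

text \<open>Without arcs only the empty walk is left, and it ends where it starts. This provides the
  cut-set that makes the least size attained and at most the number of links.\<close>

lemma cut_set_arcs:
  assumes "s \<noteq> t"
  shows "cut_set N s t (arcs N)"
proof -
  have "\<not> pre_digraph.apath (delete_links N (arcs N)) s p t" for p
    using assms by (auto simp: pre_digraph.apath_def pre_digraph.awalk_def delete_links_def
        pre_digraph.cas.simps)
  then show ?thesis by (simp add: cut_set_def has_path_def)
qed

lemma min_cut_size_le: "cut_set N s t C \<Longrightarrow> min_cut_size N s t \<le> card C"
  unfolding min_cut_size_def by (rule Least_le) blast

lemma min_cut_size_attained:
  assumes "cut_set N s t D"
  obtains C where "cut_set N s t C" "card C = min_cut_size N s t"
proof -
  have "\<exists>C. cut_set N s t C \<and> card C = min_cut_size N s t"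
    unfolding min_cut_size_def by (rule LeastI_ex) (use assms in blast)
  with that show ?thesis by blast
qed

text \<open>Comparing a minimum cut-set with one that attains the least size links the two notions,
  so that the leading coefficient counts minimum cut-sets.\<close>

lemma minimum_cut_set_iff:
  "minimum_cut_set N s t C \<longleftrightarrow> cut_set N s t C \<and> card C = min_cut_size N s t"
  unfolding minimum_cut_set_def
  by (metis min_cut_size_attained min_cut_size_le order_antisym)

lemma finite_cut_sets: "finite (arcs N) \<Longrightarrow> finite {C. cut_set N s t C}"
  by (rule finite_subset[of _ "Pow (arcs N)"]) (auto simp: cut_set_def)

text \<open>The indicator of \<open>C\<close> is the outcome with exactly the links of
  \<open>C\<close> in outage. It takes the default value \<open>False\<close> off
  \<open>arcs N\<close>, so its mass is the product over the links.\<close>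

lemma pmf_link_outages:
  assumes "finite (arcs N)" "C \<subseteq> arcs N" "p \<in> {0..1}"
  shows "pmf (link_outages N p) (\<lambda>e. e \<in> C) = p ^ card C * (1 - p) ^ (card (arcs N) - card C)"
proof -
  have "pmf (link_outages N p) (\<lambda>e. e \<in> C) = (\<Prod>e\<in>arcs N. pmf (bernoulli_pmf p) (e \<in> C))"
    unfolding link_outages_def using assms by (intro pmf_Pi') auto
  also have "\<dots> = (\<Prod>e\<in>arcs N. if e \<in> C then p else 1 - p)"
    using assms by (intro prod.cong) auto
  also have "\<dots> = p ^ card (arcs N \<inter> C) * (1 - p) ^ card (arcs N - C)"
    using assms by (simp add: prod.If_cases Diff_eq)
  also have "\<dots> = p ^ card C * (1 - p) ^ (card (arcs N) - card C)"
    using assms by (simp add: Int_absorb1 card_Diff_subset finite_subset)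
  finally show ?thesis .
qed

lemma outage_prob_eq_sum_cut_sets:
  assumes fin: "finite (arcs N)" and p: "p \<in> {0..1}"
  shows "outage_prob N s t p =
    (\<Sum>C\<in>{C. cut_set N s t C}. p ^ card C * (1 - p) ^ (card (arcs N) - card C))"
proof -
  let ?cuts = "{C. cut_set N s t C}" and ?ind = "\<lambda>C e. e \<in> C"
  have "outage_prob N s t p = measure_pmf.prob (link_outages N p) (?ind ` ?cuts)"
    unfolding outage_prob_def
  \<comment> \<open>The two events need not be equal as sets: an outcome may be \<open>True\<close>
    off \<open>arcs N\<close>, but then it has mass 0.\<close>
  proof (rule measure_prob_cong_0)
    fix \<omega>
    assume \<omega>: "\<omega> \<in> {\<omega>. \<not> has_path (delete_links N {e \<in> arcs N. \<omega> e}) s t} - ?ind ` ?cuts"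
    then have "cut_set N s t {e \<in> arcs N. \<omega> e}" by (auto simp: cut_set_def)
    with \<omega> have "\<omega> \<noteq> (\<lambda>e. e \<in> {e \<in> arcs N. \<omega> e})" by blast
    then have "\<exists>e. e \<notin> arcs N \<and> \<omega> e" by auto
    then show "pmf (link_outages N p) \<omega> = 0"
      unfolding link_outages_def using fin by (auto intro: pmf_Pi_outside)
  next
    fix \<omega>
    \<comment> \<open>In this direction the difference is empty, and the goal follows from a
      contradiction.\<close>
    assume "\<omega> \<in> ?ind ` ?cuts - {\<omega>. \<not> has_path (delete_links N {e \<in> arcs N. \<omega> e}) s t}"
    then obtain C where "cut_set N s t C" "has_path (delete_links N {e \<in> arcs N. e \<in> C}) s t"
      by auto
    moreover from this have "{e \<in> arcs N. e \<in> C} = C" by (auto simp: cut_set_def)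
    ultimately show "pmf (link_outages N p) \<omega> = 0" by (simp add: cut_set_def)
  qed
  also have "\<dots> = sum (pmf (link_outages N p)) (?ind ` ?cuts)"
    using finite_cut_sets[OF fin] by (intro measure_measure_pmf_finite finite_imageI)
  also have "\<dots> = (\<Sum>C\<in>?cuts. pmf (link_outages N p) (?ind C))"
    by (subst sum.reindex) (auto simp: inj_on_def fun_eq_iff)
  also have "\<dots> = (\<Sum>C\<in>?cuts. p ^ card C * (1 - p) ^ (card (arcs N) - card C))"
    using assms by (intro sum.cong) (auto intro!: pmf_link_outages simp: cut_set_def)
  finally show ?thesis .
qed

lemma outage_prob_eq_polynomial:
  assumes fin: "finite (arcs N)" and p: "p \<in> {0..1}"
  shows "outage_prob N s t p = (\<Sum>i = min_cut_size N s t..card (arcs N).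
    real (num_cut_sets N s t i) * p ^ i * (1 - p) ^ (card (arcs N) - i))"
proof -
  let ?cuts = "{C. cut_set N s t C}" and ?n = "card (arcs N)"
  \<comment> \<open>All sizes lie in the summation range, so grouping by size loses no cut-set; the
    summand depends on the size only.\<close>
  have "card ` ?cuts \<subseteq> {min_cut_size N s t..?n}"
    using fin by (auto simp: min_cut_size_le) (auto simp: cut_set_def card_mono)
  then have "outage_prob N s t p = (\<Sum>i = min_cut_size N s t..?n.
      \<Sum>C\<in>{C \<in> ?cuts. card C = i}. p ^ card C * (1 - p) ^ (?n - card C))"
    unfolding outage_prob_eq_sum_cut_sets[OF assms]
    by (intro sum.group[symmetric] finite_cut_sets fin) auto
  also have "\<dots> = (\<Sum>i = min_cut_size N s t..?n.
      real (num_cut_sets N s t i) * p ^ i * (1 - p) ^ (?n - i))"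
    by (intro sum.cong refl) (simp add: num_cut_sets_def)
  finally show ?thesis .
qed

lemma leading_term_tendsto:
  fixes a :: "nat \<Rightarrow> real"
  assumes "m \<le> n" "a m \<noteq> 0"
  shows "((\<lambda>p. (\<Sum>i=m..n. a i * p ^ i * (1 - p) ^ (n - i)) / (a m * p ^ m)) \<longlongrightarrow> 1) (at_right 0)"
proof -
  let ?g = "\<lambda>p. \<Sum>i=m..n. a i / a m * p ^ (i - m) * (1 - p) ^ (n - i)"
  have "((\<lambda>p. ?g p) \<longlongrightarrow> ?g 0) (at_right 0)"
    by (intro tendsto_intros)
  \<comment> \<open>At 0 the factor \<open>p ^ (i - m)\<close> is 1 for \<open>i = m\<close> and
    vanishes for larger \<open>i\<close>.\<close>
  also have "?g 0 = (\<Sum>i\<in>{m..n}. if i = m then 1 else 0)"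
    using assms(2) by (intro sum.cong) auto
  also have "\<dots> = 1" using assms(1) by simp
  finally have "(?g \<longlongrightarrow> 1) (at_right 0)" .
  moreover have "\<forall>\<^sub>F p in at_right 0.
      ?g p = (\<Sum>i=m..n. a i * p ^ i * (1 - p) ^ (n - i)) / (a m * p ^ m)"
    using eventually_at_right_less
  proof eventually_elim
    case (elim p)
    then show ?case
      by (auto simp: sum_divide_distrib power_diff intro!: sum.cong)
  qed
  ultimately show ?thesis by (rule Lim_transform_eventually)
qed

theorem theorem1:
  fixes N :: "('v, 'e) pre_digraph" and s t :: 'v
    and n m :: nat and A :: "nat \<Rightarrow> nat" and outage :: "real \<Rightarrow> real"
  assumes "network N s t"
    and "n = card (arcs N)"
    and "m = min_cut_size N s t"
    and "\<And>i. m \<le> i \<Longrightarrow> i \<le> n \<Longrightarrow> A i = num_cut_sets N s t i"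
    and "outage = outage_prob N s t"
  shows "(\<forall>p\<in>{0..1}. outage p = (\<Sum>i=m..n. real (A i) * p ^ i * (1 - p) ^ (n - i))) \<and>
    ((\<lambda>p. outage p / (real (A m) * p ^ m)) \<longlongrightarrow> 1) (at_right 0) \<and>
    diversity_order outage = real m \<and>
    coding_gain outage = real (A m) \<and>
    A m = card {C. minimum_cut_set N s t C}"
proof -
  interpret network N s t by fact
  have fin: "finite (arcs N)" by simp
  have cut: "cut_set N s t (arcs N)"
    using source_neq_terminal by (rule cut_set_arcs)
  \<comment> \<open>The values of \<open>A\<close> are prescribed only from \<open>m\<close> to
    \<open>n\<close>, so this bound is what identifies \<open>A m\<close>.\<close>
  have "m \<le> n" using min_cut_size_le[OF cut] assms(2,3) by simp
  then have A_m: "A m = card {C. minimum_cut_set N s t C}"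
    using assms(3,4) by (simp add: num_cut_sets_def minimum_cut_set_iff)
  obtain C where "minimum_cut_set N s t C"
    using min_cut_size_attained[OF cut] by (metis minimum_cut_set_iff)
  \<comment> \<open>Existence alone does not make \<open>A m\<close> nonzero, since
    \<open>card\<close> is 0 on infinite sets.\<close>
  moreover have "finite {C. minimum_cut_set N s t C}"
    by (rule finite_subset[OF _ finite_cut_sets[OF fin, of s t]]) (auto simp: minimum_cut_set_def)
  ultimately have "A m \<noteq> 0" unfolding A_m by auto
  have poly: "outage p = (\<Sum>i=m..n. real (A i) * p ^ i * (1 - p) ^ (n - i))" if "p \<in> {0..1}" for p
    using outage_prob_eq_polynomial[OF fin that] assms(2-5) by simp
  \<comment> \<open>Below 1 the polynomial formula applies; above 0 the natural power agrees with
    \<open>powr\<close>, as the real exponent in \<open>high_snr_law\<close> requires.\<close>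
  have ev: "\<forall>\<^sub>F p in at_right (0::real). 0 < p \<and> p < 1"
    by (auto simp: eventually_at_right_field intro: exI[of _ 1])
  have lim: "((\<lambda>p. outage p / (real (A m) * p ^ m)) \<longlongrightarrow> 1) (at_right 0)"
  proof (rule Lim_transform_eventually)
    show "((\<lambda>p. (\<Sum>i=m..n. real (A i) * p ^ i * (1 - p) ^ (n - i)) / (real (A m) * p ^ m))
        \<longlongrightarrow> 1) (at_right 0)"
      using \<open>m \<le> n\<close> \<open>A m \<noteq> 0\<close> leading_term_tendsto[of m n "\<lambda>i. real (A i)"] by simp
    show "\<forall>\<^sub>F p in at_right 0. (\<Sum>i=m..n. real (A i) * p ^ i * (1 - p) ^ (n - i)) /
        (real (A m) * p ^ m) = outage p / (real (A m) * p ^ m)"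
      using ev by eventually_elim (simp add: poly)
  qed
  have "high_snr_law outage (real (A m)) (real m)"
    unfolding high_snr_law_def
  proof (rule Lim_transform_eventually[OF lim])
    show "\<forall>\<^sub>F p in at_right 0.
        outage p / (real (A m) * p ^ m) = outage p / (real (A m) * p powr real m)"
      using ev by eventually_elim (simp add: powr_realpow)
  qed
  with poly lim A_m show ?thesis
    using diversity_order_eq coding_gain_eq by blast
qed

end
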